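(* Let $G$ be a parity game all of whose node colors are in $\{0,1\}$. Then $\mathtt{psolB}$ completely solves $G$, i.e. $\mathtt{psolB}(G)$ is the empty game.
   Context: A parity game is a tuple $G=(V,V_0,V_1,E,c)$ where $V$ is a finite set of nodes partitioned into $V_0,V_1$, $E\subseteq V\times V$ with every node having a successor, and $c\colon V\to\mathbb{N}$. Let $v.E=\{w\mid(v,w)\in E\}$. For $U\subseteq V$, $G\setminus U$ is the game restricted to $V\setminus U$. $\mathrm{Attr}_p(G,X)$ is the least fixed point of $Z\mapsto X\cup\{v\in V_p\mid v.E\cap Z\ne\emptyset\}\cup\{v\in V_{1-p}\mid v.E\subseteq Z\}$. Let $\mathrm{mpre}_p(A,X,d)=\{v\in V_p\mid c(v)\geq d \wedge v.E\cap(A\cup X)\neq\emptyset\}\cup\{v\in V_{1-p}\mid c(v)\geq d\wedge v.E\subseteq A\cup X\}$; for a nonempty set $X$ of nodes of common color $d$, $\mathrm{MAttr}(X)$ is the least fixed point of $Z\mapsto\mathrm{mpre}_{d\bmod 2}(Z,X,d)$ in the current game. Algorithm $\mathtt{psolB}(G)$: for each color $d$ of $G$ in descending order: let $X$ be the set of nodes of color $d$; repeat: if $X=\emptyset$ go to the next color; if $X\subseteq\mathrm{MAttr}(X)$, return $\mathtt{psolB}(G\setminus\mathrm{Attr}_{d\bmod 2}(G,\mathrm{MAttr}(X)))$; else set $X:=X\cap\mathrm{MAttr}(X)$. If all colors are processed, return $G$. (The removed sets are classified as won by player $d\bmod 2$.) *)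

theory Defs
  imports Main
begin

record 'v game =
  nodes  :: "'v set"
  nodes0 :: "'v set"
  nodes1 :: "'v set"
  edges  :: "('v \<times> 'v) set"
  color  :: "'v \<Rightarrow> nat"

definition parity_game :: "'v game \<Rightarrow> bool" where
  "parity_game G \<longleftrightarrow>
     finite (nodes G) \<and>
     nodes0 G \<union> nodes1 G = nodes G \<and> nodes0 G \<inter> nodes1 G = {} \<and>
     edges G \<subseteq> nodes G \<times> nodes G \<and>
     (\<forall>v\<in>nodes G. \<exists>w. (v, w) \<in> edges G)"

definition owned :: "'v game \<Rightarrow> nat \<Rightarrow> 'v set" where
  "owned G p = (if p = 0 then nodes0 G else nodes1 G)"

definition succs :: "'v game \<Rightarrow> 'v \<Rightarrow> 'v set" where
  "succs G v = {w. (v, w) \<in> edges G}"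

text \<open>The coloring stays a total function; only its values on the remaining nodes matter.\<close>

definition remove_nodes :: "'v game \<Rightarrow> 'v set \<Rightarrow> 'v game" where
  "remove_nodes G U =
     \<lparr> nodes = nodes G - U, nodes0 = nodes0 G - U, nodes1 = nodes1 G - U,
       edges = edges G \<inter> ((nodes G - U) \<times> (nodes G - U)), color = color G \<rparr>"

definition Attr :: "nat \<Rightarrow> 'v game \<Rightarrow> 'v set \<Rightarrow> 'v set" where
  "Attr p G X = lfp (\<lambda>Z. X \<union> {v \<in> owned G p. succs G v \<inter> Z \<noteq> {}}
                          \<union> {v \<in> owned G (1 - p). succs G v \<subseteq> Z})"

definition mpre :: "nat \<Rightarrow> 'v game \<Rightarrow> 'v set \<Rightarrow> 'v set \<Rightarrow> nat \<Rightarrow> 'v set" where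
  "mpre p G A X d =
     {v \<in> owned G p. color G v \<ge> d \<and> succs G v \<inter> (A \<union> X) \<noteq> {}} \<union>
     {v \<in> owned G (1 - p). color G v \<ge> d \<and> succs G v \<subseteq> A \<union> X}"

text \<open>The argument \<open>d\<close> is the common color of the nodes in \<open>X\<close>.\<close>

definition MAttr :: "'v game \<Rightarrow> nat \<Rightarrow> 'v set \<Rightarrow> 'v set" where
  "MAttr G d X = lfp (\<lambda>Z. mpre (d mod 2) G Z X d)"

definition color_class :: "'v game \<Rightarrow> nat \<Rightarrow> 'v set" where
  "color_class G d = {v \<in> nodes G. color G v = d}"

definition colors_desc :: "'v game \<Rightarrow> nat list" where
  "colors_desc G = rev (sorted_list_of_set (color G ` nodes G))"

text \<open>
  The inner loop for a fixed color \<open>d\<close>. The result is empty exactly when the loop moves on to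
  the next color; otherwise it is the set \<open>X\<close> with \<open>X \<subseteq> MAttr(X)\<close> at which the loop stops.
  Both functions below are tail-recursive and need no termination proof to be defined. On an input
  where the recursion diverges the value is the unspecified \<open>undefined\<close>; for games with finitely
  many nodes this does not happen.
\<close>

partial_function (tailrec) refine :: "'v game \<Rightarrow> nat \<Rightarrow> 'v set \<Rightarrow> 'v set" where
  "refine G d X =
     (if X = {} then {}
      else if X \<subseteq> MAttr G d X then X
      else refine G d (X \<inter> MAttr G d X))"

partial_function (tailrec) psolB :: "'v game \<Rightarrow> 'v game" where
  "psolB G =
     (case find (\<lambda>d. refine G d (color_class G d) \<noteq> {}) (colors_desc G) of
        None \<Rightarrow> G
      | Some d \<Rightarrow>
          psolB (remove_nodes G
                   (Attr (d mod 2) G (MAttr G d (refine G d (color_class G d))))))"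

end

theory Submission imports Defs begin

text \<open>
  Suppose that the loop for color 1 ends with the empty set. Let \<open>X\<close> be the set of nodes of color 0
  and \<open>W\<close> the complement of \<open>MAttr(X)\<close>. From every node of \<open>W\<close> player 1 can force the next node to
  be a node of \<open>W\<close> of color 1, so the set \<open>Y\<close> of nodes of color 1 in \<open>W\<close> satisfies \<open>Y \<subseteq> MAttr(Y)\<close>
  and would survive the loop for color 1. Hence \<open>Y\<close>, and with it \<open>W\<close>, is empty, and the very first
  test for color 0 succeeds. So on a nonempty game \<open>psolB\<close> always removes some nodes, and what
  remains is again a parity game with colors in \<open>{0, 1}\<close>.
\<close>

lemma mpre_mono: "Z \<subseteq> Z' \<Longrightarrow> X \<subseteq> X' \<Longrightarrow> mpre p G Z X d \<subseteq> mpre p G Z' X' d"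
  unfolding mpre_def by blast

lemma mono_mpre: "mono (\<lambda>Z. mpre p G Z X d)"
  by (intro monoI mpre_mono) auto

lemma MAttr_mono: "X \<subseteq> Y \<Longrightarrow> MAttr G d X \<subseteq> MAttr G d Y"
  unfolding MAttr_def by (intro lfp_mono mpre_mono) auto

lemma MAttr_unfold: "MAttr G d X = mpre (d mod 2) G (MAttr G d X) X d"
  unfolding MAttr_def by (rule lfp_unfold[OF mono_mpre])

lemma Attr_unfold:
  "Attr p G X = X \<union> {v \<in> owned G p. succs G v \<inter> Attr p G X \<noteq> {}}
                  \<union> {v \<in> owned G (1 - p). succs G v \<subseteq> Attr p G X}"
  unfolding Attr_def by (rule lfp_unfold) (rule monoI, blast)

text \<open>Every node has a successor, so even the condition on the opponent's nodes cannot hold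
  vacuously, and the iteration from the empty set never starts.\<close>

lemma MAttr_empty:
  assumes "parity_game G"
  shows "MAttr G d {} = {}"
proof -
  have "mpre (d mod 2) G {} {} d \<subseteq> {}"
    using assms unfolding mpre_def parity_game_def owned_def succs_def
    by (auto split: if_splits)
  then have "MAttr G d {} \<subseteq> {}"
    unfolding MAttr_def by (rule lfp_lowerbound)
  then show ?thesis by simp
qed

text \<open>Only dead ends could spoil the smaller game. A node of player \<open>p\<close> outside
  the attractor has no successor in it, and a node of the opponent has at least one outside
  it.\<close>

lemma parity_game_remove_Attr:
  assumes "parity_game G" "p \<le> 1"
  shows "parity_game (remove_nodes G (Attr p G X))"
proof -
  let ?A = "Attr p G X"
  have "\<exists>w. (v, w) \<in> edges G \<and> w \<in> nodes G - ?A" if v: "v \<in> nodes G" "v \<notin> ?A" for v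
  proof -
    have E: "edges G \<subseteq> nodes G \<times> nodes G" and "succs G v \<noteq> {}"
      using assms(1) v(1) unfolding parity_game_def succs_def by auto
    have "v \<in> owned G p \<or> v \<in> owned G (1 - p)"
      using assms v(1) unfolding parity_game_def owned_def by auto
    with v(2) have "succs G v \<inter> ?A = {} \<or> \<not> succs G v \<subseteq> ?A"
      using Attr_unfold[of p G X] by blast
    with \<open>succs G v \<noteq> {}\<close> have "\<not> succs G v \<subseteq> ?A" by blast
    then show ?thesis using E unfolding succs_def by blast
  qed
  then show ?thesis
    using assms(1) unfolding parity_game_def remove_nodes_def by auto
qed

text \<open>By monotonicity of \<open>MAttr\<close>, intersecting \<open>X\<close> with
  \<open>MAttr G d X\<close> loses no subset \<open>Y\<close> with
  \<open>Y \<subseteq> MAttr G d Y\<close>. The loop thus computes the greatest such subset, and any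
  witness \<open>Y\<close> shows that its result is nonempty.\<close>

lemma refine_greatest:
  assumes "finite X"
  shows "refine G d X \<subseteq> X \<and> refine G d X \<subseteq> MAttr G d (refine G d X) \<and>
    (\<forall>Y\<subseteq>X. Y \<subseteq> MAttr G d Y \<longrightarrow> Y \<subseteq> refine G d X)"
  using assms
proof (induction X rule: finite_psubset_induct)
  case (psubset X)
  show ?case
  proof (cases "X = {} \<or> X \<subseteq> MAttr G d X")
    case True
    then have "refine G d X = X" by (auto simp: refine.simps[of G d X])
    with True show ?thesis by auto
  next
    case False
    then have eq: "refine G d X = refine G d (X \<inter> MAttr G d X)"
      by (simp add: refine.simps[of G d X])
    from False have "X \<inter> MAttr G d X \<subset> X" by blast
    note IH = psubset.IH[OF this]
    have "Y \<subseteq> X \<inter> MAttr G d X" if "Y \<subseteq> X" "Y \<subseteq> MAttr G d Y" for Y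
      using that MAttr_mono[of Y X G d] by blast
    with IH have "\<forall>Y\<subseteq>X. Y \<subseteq> MAttr G d Y \<longrightarrow> Y \<subseteq> refine G d (X \<inter> MAttr G d X)"
      by simp
    with IH show ?thesis unfolding eq by simp
  qed
qed

lemma refine_color_class_nonempty:
  assumes G: "parity_game G" and colors: "\<forall>v\<in>nodes G. color G v \<in> {0, 1}"
    and "nodes G \<noteq> {}"
  shows "\<exists>d\<in>color G ` nodes G. refine G d (color_class G d) \<noteq> {}"
proof (rule ccontr)
  assume none: "\<not> ?thesis"
  have fin: "finite (color_class G d)" for d
    using G unfolding parity_game_def color_class_def by auto
  \<comment> \<open>This covers every \<open>d\<close>: a nonempty \<open>Y\<close> itself shows
    that the color \<open>d\<close> occurs, which \<open>none\<close> requires.\<close>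
  have stable_empty: "Y = {}" if "Y \<subseteq> color_class G d" "Y \<subseteq> MAttr G d Y" for d Y
  proof (rule ccontr)
    assume "Y \<noteq> {}"
    with that(1) have "d \<in> color G ` nodes G"
      unfolding color_class_def by blast
    with none have "refine G d (color_class G d) = {}" by blast
    moreover have "Y \<subseteq> refine G d (color_class G d)"
      using refine_greatest[OF fin] that by blast
    ultimately show False using \<open>Y \<noteq> {}\<close> by blast
  qed
  define X where "X = color_class G 0"
  define M where "M = MAttr G 0 X"
  define W where "W = nodes G - M"
  define Y where "Y = {v \<in> W. color G v = 1}"
  have owned: "v \<in> owned G 0 \<or> v \<in> owned G 1" and succ_nonempty: "succs G v \<noteq> {}"
    if "v \<in> nodes G" for v
    using G that unfolding parity_game_def owned_def succs_def by auto
  have M: "mpre 0 G M X 0 \<subseteq> M"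
    unfolding M_def using MAttr_unfold[of G 0 X] by simp
  have outside: "w \<in> Y" if "w \<in> succs G v" "w \<notin> M" "w \<notin> X" for v w
  proof -
    have "w \<in> nodes G"
      using G that(1) unfolding parity_game_def succs_def by blast
    with that colors show ?thesis
      unfolding Y_def W_def X_def color_class_def by auto
  qed
  \<comment> \<open>For \<open>d = 0\<close> the color bound in \<open>mpre\<close> is vacuous, so a
    node can be outside \<open>M\<close> only because of its moves. The moves that avoid both
    \<open>M\<close> and \<open>X\<close> end in \<open>Y\<close>.\<close>
  have trap: "v \<in> owned G 0 \<and> succs G v \<subseteq> Y \<or> v \<in> owned G 1 \<and> succs G v \<inter> Y \<noteq> {}"
    if "v \<in> W" for v
  proof -
    from that have "v \<in> nodes G" "v \<notin> mpre 0 G M X 0"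
      using M unfolding W_def by auto
    then have "v \<in> owned G 0 \<and> succs G v \<inter> (M \<union> X) = {}
        \<or> v \<in> owned G 1 \<and> \<not> succs G v \<subseteq> M \<union> X"
      using owned[of v] unfolding mpre_def by auto
    then show ?thesis using outside[of _ v] by blast
  qed
  \<comment> \<open>A single move suffices, as \<open>trap\<close> already leads back into
    \<open>Y\<close>; the bound \<open>d = 1\<close> holds by the choice of
    \<open>Y\<close>.\<close>
  have "Y \<subseteq> mpre 1 G (MAttr G 1 Y) Y 1"
  proof
    fix v assume "v \<in> Y"
    then have "v \<in> W" "color G v = 1" unfolding Y_def by auto
    with trap[of v] show "v \<in> mpre 1 G (MAttr G 1 Y) Y 1"
      unfolding mpre_def by auto
  qed
  then have "Y \<subseteq> MAttr G 1 Y"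
    using MAttr_unfold[of G 1 Y] by simp
  then have "Y = {}"
    by (rule stable_empty[rotated]) (auto simp: Y_def W_def color_class_def)
  have "W = {}"
  proof (rule ccontr)
    assume "W \<noteq> {}"
    then obtain v where "v \<in> W" by blast
    \<comment> \<open>With \<open>Y\<close> empty, only the first case of \<open>trap\<close> could
      hold, and it would make \<open>v\<close> a dead end.\<close>
    then have "succs G v \<noteq> {}" using succ_nonempty unfolding W_def by blast
    with trap[OF \<open>v \<in> W\<close>] \<open>Y = {}\<close> show False by blast
  qed
  then have "X \<subseteq> MAttr G 0 X"
    unfolding W_def M_def X_def color_class_def by blast
  then have "X = {}"
    by (rule stable_empty[rotated]) (simp add: X_def)
  \<comment> \<open>\<open>W = {}\<close> says that \<open>M\<close> covers all nodes, so an empty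
    \<open>M\<close> contradicts nonemptiness of the game.\<close>
  then have "M = {}"
    unfolding M_def using MAttr_empty[OF G] by simp
  with \<open>W = {}\<close> \<open>nodes G \<noteq> {}\<close> show False
    unfolding W_def by simp
qed

theorem theorem7:
  fixes G :: "'v game"
  assumes "parity_game G"
    and "\<forall>v\<in>nodes G. color G v \<in> {0, 1}"
  shows "nodes (psolB G) = {}"
  using assms
proof (induction "card (nodes G)" arbitrary: G rule: less_induct)
  case less
  let ?P = "\<lambda>d. refine G d (color_class G d) \<noteq> {}"
  have fin: "finite (nodes G)" using less.prems(1) unfolding parity_game_def by blast
  have set_colors: "set (colors_desc G) = color G ` nodes G"
    unfolding colors_desc_def using fin by simp
  show ?case
  proof (cases "find ?P (colors_desc G)")
    case None
    then have "nodes G = {}"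
      using refine_color_class_nonempty[OF less.prems] set_colors
      unfolding find_None_iff by blast
    with None show ?thesis by (subst psolB.simps) simp
  next
    case (Some d)
    let ?X = "refine G d (color_class G d)"
    let ?A = "Attr (d mod 2) G (MAttr G d ?X)"
    let ?G' = "remove_nodes G ?A"
    have "?X \<noteq> {}" using Some unfolding find_Some_iff by auto
    moreover have "?X \<subseteq> nodes G \<and> ?X \<subseteq> MAttr G d ?X"
      using refine_greatest[of "color_class G d" G d] fin
      unfolding color_class_def by auto
    moreover have "MAttr G d ?X \<subseteq> ?A" by (subst Attr_unfold) blast
    \<comment> \<open>The nonempty set \<open>?X\<close> lies in the removed part, which gives the
      strict decrease for the induction.\<close>
    ultimately have "nodes G - ?A \<subset> nodes G" by blast
    then have "card (nodes ?G') < card (nodes G)"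
      using fin by (simp add: remove_nodes_def psubset_card_mono)
    moreover have "parity_game ?G'"
      using less.prems(1) by (rule parity_game_remove_Attr) auto
    moreover have "\<forall>v\<in>nodes ?G'. color ?G' v \<in> {0, 1}"
      using less.prems(2) by (simp add: remove_nodes_def)
    ultimately have "nodes (psolB ?G') = {}" by (rule less.hyps)
    moreover have "psolB G = psolB ?G'"
      by (subst psolB.simps) (simp add: Some)
    ultimately show ?thesis by simp
  qed
qed

end
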